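(* Let $F,\bar F\subseteq\mathbb{N}$ be reciprocals, not both equal to $\{0\}$, and let $r$ be the least positive integer in $F\cup\bar F$. Then for every positive integer $n$, \[ |F\cap[0,n]|+|\bar F\cap[0,n]|\ge 2+\Big\lfloor\log_2\frac{n}{r}\Big\rfloor. \]
   Context: Sets $F,\bar F\subseteq\mathbb{N}=\{0,1,2,\dots\}$ are reciprocals if $\big(\sum_{a\in F}q^a\big)\big(\sum_{b\in\bar F}q^b\big)=1$ in $\mathbb{F}_2[[q]]$ (in particular both contain $0$). *)

theory Defs
  imports Complex_Main "HOL-Library.Z2" "HOL-Computational_Algebra.Formal_Power_Series"
begin

text \<open>The type \<^typ>\<open>bit\<close> is the two-element field, so \<^typ>\<open>bit fps\<close> is the ring of
  formal power series over it.\<close>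

definition set_fps :: "nat set \<Rightarrow> bit fps" where
  "set_fps F = Abs_fps (\<lambda>n. of_bool (n \<in> F))"

definition reciprocals :: "nat set \<Rightarrow> nat set \<Rightarrow> bool" where
  "reciprocals F G \<longleftrightarrow> set_fps F * set_fps G = 1"

end

theory Submission
  imports Defs
begin

text \<open>If neither set met \<open>(m, 2m]\<close>, let \<open>a\<close> and \<open>b\<close> be the largest elements of the two sets
  in \<open>[0, m]\<close>. Then \<open>a + b\<close> is the only way to write this number as a sum with one term from
  each set, so the product has coefficient \<open>1\<close> there and \<open>a + b = 0\<close>. Hence, from \<open>r\<close> on,
  every doubling of \<open>n\<close> adds an element to one of the sets.\<close>

lemma set_fps_nth [simp]: "fps_nth (set_fps F) n = of_bool (n \<in> F)"
  by (simp add: set_fps_def)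

lemma reciprocals_zero_mem:
  assumes "reciprocals F G"
  shows "0 \<in> F" "0 \<in> G"
proof -
  have "fps_nth (set_fps F * set_fps G) 0 = 1"
    using assms by (simp add: reciprocals_def)
  then show "0 \<in> F" "0 \<in> G"
    by (auto split: if_splits simp: of_bool_def)
qed

text \<open>In the convolution, \<open>i > a\<close> kills the factor from \<open>f\<close>, while
  \<open>i < a\<close> pushes the other index above \<open>b\<close> and kills the factor from
  \<open>g\<close>. Vanishing is assumed only up to \<open>a + b\<close>, so the series may have
  further terms later.\<close>

lemma fps_mult_nth_single:
  fixes f g :: "'a::comm_semiring_1 fps"
  assumes "\<And>i. a < i \<Longrightarrow> i \<le> a + b \<Longrightarrow> fps_nth f i = 0"
    and "\<And>j. b < j \<Longrightarrow> j \<le> a + b \<Longrightarrow> fps_nth g j = 0"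
  shows "fps_nth (f * g) (a + b) = fps_nth f a * fps_nth g b"
proof -
  have zero: "fps_nth f i * fps_nth g (a + b - i) = 0" if "i \<le> a + b" "i \<noteq> a" for i
    using assms(1)[of i] assms(2)[of "a + b - i"] that by (cases "i < a") auto
  have "fps_nth (f * g) (a + b) = (\<Sum>i\<in>{0..a + b}. fps_nth f i * fps_nth g (a + b - i))"
    by (rule fps_mult_nth)
  also have "\<dots> = (\<Sum>i\<in>{a}. fps_nth f i * fps_nth g (a + b - i))"
    by (rule sum.mono_neutral_right) (use zero in auto)
  finally show ?thesis by simp
qed

lemma reciprocals_meet_doubling:
  assumes rec: "reciprocals F G" and r: "0 < r" "r \<in> F \<union> G" "r \<le> m"
  shows "(F \<union> G) \<inter> {m<..2 * m} \<noteq> {}"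
proof
  assume empty: "(F \<union> G) \<inter> {m<..2 * m} = {}"
  define a where "a = Max (F \<inter> {0..m})"
  define b where "b = Max (G \<inter> {0..m})"
  have nonempty: "F \<inter> {0..m} \<noteq> {}" "G \<inter> {0..m} \<noteq> {}"
    using reciprocals_zero_mem[OF rec] by auto
  have a: "a \<in> F" "a \<le> m"
    using Max_in[of "F \<inter> {0..m}"] nonempty by (auto simp: a_def)
  have b: "b \<in> G" "b \<le> m"
    using Max_in[of "G \<inter> {0..m}"] nonempty by (auto simp: b_def)
  have le_a: "i \<le> a" if "i \<in> F" "i \<le> m" for i
    using that by (auto simp: a_def intro!: Max_ge)
  have le_b: "j \<le> b" if "j \<in> G" "j \<le> m" for j
    using that by (auto simp: b_def intro!: Max_ge)
  \<comment> \<open>Since \<open>a + b \<le> 2 * m\<close>, such an index is either at most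
    \<open>m\<close>, where maximality of \<open>a\<close> excludes it, or in the interval assumed
    empty.\<close>
  have F: "i \<notin> F" if "a < i" "i \<le> a + b" for i
    using le_a[of i] that a(2) b(2) empty by (cases "i \<le> m") auto
  have G: "j \<notin> G" if "b < j" "j \<le> a + b" for j
    using le_b[of j] that a(2) b(2) empty by (cases "j \<le> m") auto
  have "fps_nth (set_fps F * set_fps G) (a + b) = 1"
    using a(1) b(1) F G by (subst fps_mult_nth_single) auto
  then have "a + b = 0"
    using rec by (simp add: reciprocals_def split: if_splits)
  \<comment> \<open>Now \<open>a = b = 0\<close>, yet \<open>r\<close> is a positive element of one
    of the sets and at most \<open>m\<close>.\<close>
  then show False
    using r le_a[of r] le_b[of r] by auto
qed

lemma card_Int_mono:
  fixes F :: "nat set"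
  assumes "m \<le> n"
  shows "card (F \<inter> {0..m}) \<le> card (F \<inter> {0..n})"
  using assms by (intro card_mono) auto

lemma card_Int_less:
  fixes F :: "nat set"
  assumes "x \<in> F" "m < x" "x \<le> n"
  shows "card (F \<inter> {0..m}) < card (F \<inter> {0..n})"
proof (rule psubset_card_mono)
  have "x \<in> F \<inter> {0..n}" "x \<notin> F \<inter> {0..m}"
    using assms by auto
  then show "F \<inter> {0..m} \<subset> F \<inter> {0..n}"
    using assms by force
qed simp

lemma reciprocals_card_ge_2:
  assumes "reciprocals F G"
  shows "2 \<le> card (F \<inter> {0..n}) + card (G \<inter> {0..n})"
proof -
  have "0 < card (F \<inter> {0..n})" "0 < card (G \<inter> {0..n})"
    using reciprocals_zero_mem[OF assms] by (auto simp: card_gt_0_iff)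
  then show ?thesis by linarith
qed

text \<open>A power of two in place of the logarithm allows induction on \<open>k\<close>: halving
  \<open>n\<close> lowers the exponent by one and loses at least one element.\<close>

lemma reciprocals_card_ge:
  assumes rec: "reciprocals F G" and r: "0 < r" "r \<in> F \<union> G"
    and "r * 2 ^ k \<le> n"
  shows "2 + k \<le> card (F \<inter> {0..n}) + card (G \<inter> {0..n})"
  using assms(4)
proof (induction k arbitrary: n)
  case 0
  show ?case using reciprocals_card_ge_2[OF rec] by simp
next
  case (Suc k)
  \<comment> \<open>Rounding down is harmless: \<open>r * 2 ^ k\<close> is an integer at most
    \<open>n / 2\<close>, and \<open>2 * m \<le> n\<close> keeps the new element within
    \<open>n\<close>.\<close>
  define m where "m = n div 2"
  have m: "r * 2 ^ k \<le> m" "2 * m \<le> n" "m \<le> n"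
    using Suc.prems by (auto simp: m_def)
  have "r * 1 \<le> r * 2 ^ k" by (intro mult_le_mono2) simp
  then have "(F \<union> G) \<inter> {m<..2 * m} \<noteq> {}"
    using m(1) by (intro reciprocals_meet_doubling[OF rec r]) linarith
  then obtain x where "x \<in> F \<union> G" "m < x" "x \<le> 2 * m"
    by (metis Int_iff ex_in_conv greaterThanAtMost_iff)
  with m(2) have x: "x \<in> F \<union> G" "m < x" "x \<le> n"
    by auto
  have "card (F \<inter> {0..m}) + card (G \<inter> {0..m}) < card (F \<inter> {0..n}) + card (G \<inter> {0..n})"
    using x card_Int_less[of x F m n] card_Int_less[of x G m n]
      card_Int_mono[OF m(3), of F] card_Int_mono[OF m(3), of G]
    by (elim UnE) linarith+
  then show ?case using Suc.IH[OF m(1)] by linarith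
qed

theorem theorem5p2:
  fixes F G :: "nat set" and r n :: nat
  assumes "reciprocals F G"
    and "\<not> (F = {0} \<and> G = {0})"
    and "r = (LEAST k. 0 < k \<and> k \<in> F \<union> G)"
    and "0 < n"
  shows "int (card (F \<inter> {0..n})) + int (card (G \<inter> {0..n}))
           \<ge> 2 + \<lfloor>log 2 (real n / real r)\<rfloor>"
proof -
  \<comment> \<open>Both sets contain \<open>0\<close>, so one that differs from \<open>{0}\<close>
    has a positive element; hence the \<open>LEAST\<close> is attained.\<close>
  have "\<exists>k. 0 < k \<and> k \<in> F \<union> G"
    using assms(2) reciprocals_zero_mem[OF assms(1)] by (auto simp: set_eq_iff)
  from LeastI_ex[OF this] have r: "0 < r" "r \<in> F \<union> G"
    unfolding assms(3) by auto
  define k where "k = nat \<lfloor>log 2 (real n / real r)\<rfloor>"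
  show ?thesis
  \<comment> \<open>For \<open>n < r\<close> the floor is negative and \<open>nat\<close> would
    truncate it, but there the two zeros already give the bound.\<close>
  proof (cases "n < r")
    case True
    then have "log 2 (real n / real r) < 0"
      using assms(4) by simp
    then have "\<lfloor>log 2 (real n / real r)\<rfloor> \<le> 0"
      by linarith
    with reciprocals_card_ge_2[OF assms(1), of n] show ?thesis by linarith
  next
    case False
    then have "0 \<le> log 2 (real n / real r)"
      using r(1) by simp
    then have k: "int k = \<lfloor>log 2 (real n / real r)\<rfloor>"
      by (simp add: k_def)
    then have "real k \<le> log 2 (real n / real r)"
      by linarith
    then have "2 ^ k \<le> real n / real r"
      using r(1) assms(4) by (simp add: le_log_iff powr_realpow)
    then have "real (r * 2 ^ k) \<le> real n"
      using r(1) by (simp add: field_simps)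
    then have "r * 2 ^ k \<le> n"
      by (simp only: of_nat_le_iff)
    from reciprocals_card_ge[OF assms(1) r this] k show ?thesis by linarith
  qed
qed

end
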